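(* Consider a smoothed online combinatorial optimization problem with cost function $f:\mathcal{X}\times\Theta\to\mathbb{R}_{\ge0}$ and metric $d:\mathcal{X}\times\mathcal{X}\to\mathbb{R}_{\ge0}$. Suppose $f(x,\theta)$ is Lipschitz in $\theta\in\Theta$ with Lipschitz constant $L$, i.e. $\left\|\frac{\partial f(x,\theta)}{\partial\theta}\right\|\le L$ for all $x\in\mathcal{X}$, $\theta\in\Theta$, and suppose the switching cost is bounded on $\mathcal{X}$ by $B=\sup_{x,y\in\mathcal{X}}d(x,y)$, the maximal switching cost. Let a predictive model with predictions $\theta^{(t)}_s$ and uncertainties $\epsilon^{(t)}_s$ be given, as described in the context. If $\epsilon^{(t)}_{t+s-1}=o(1)$ in $t$ for all $s\in\mathbb{N}$, i.e. $\epsilon^{(t)}_{t+s-1}\to0$ as $t\to\infty$, then the cumulative dynamic regret $\mathrm{Reg}_T$ of the Dynamic Future Planning algorithm is sublinear in $T$, i.e. $\mathrm{Reg}_T$ is at most $o(T)$.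
   Context: Setting. $\mathcal{X}$ is the (combinatorial) set of feasible decisions and $\Theta$ is the set of possible parameters, in a normed space. There is a sequence of true parameters $\theta_1,\theta_2,\dots\in\Theta$. At each time $t$ the learner receives a feature $\xi_t$ correlated with the future parameters and chooses $x_t\in\mathcal{X}$ before $\theta_t$ is revealed; it then pays $f(x_t,\theta_t)+d(x_t,x_{t-1})$, where $x_0$ is the initial decision. The cost of an online algorithm is $\mathrm{cost}_T(\mathrm{ALG})=\sum_{t=1}^T \big(f(x_t,\theta_t)+d(x_t,x_{t-1})\big)$. The offline optimum, which knows all parameters in advance, has cost $\mathrm{cost}_T(\mathrm{OPT})=\min_{y_1,\dots,y_T\in\mathcal{X}}\sum_{t=1}^T \big(f(y_t,\theta_t)+d(y_t,y_{t-1})\big)$ with $y_0=x_0$. The dynamic regret is $\mathrm{Reg}_T=\mathrm{cost}_T(\mathrm{ALG})-\mathrm{cost}_T(\mathrm{OPT})$. Predictions. At each time $t$ the predictive model, trained on the parameters revealed before time $t$, takes the feature $\xi_t$ and produces predictions $\theta^{(t)}_s$ with uncertainties $\epsilon^{(t)}_s$ for all integers $s\ge t$, where $\|\theta_s-\theta^{(t)}_s\|\le\epsilon^{(t)}_s$. The uncertainty $\epsilon^{(t)}_s$ is (weakly) increasing in $s$ and (weakly) decreasing in $t$. Dynamic Future Planning algorithm. Input: the number of time steps $T$, the maximal switching cost $B$, and the predictive model. Start with $t=1$. While $t\le T$: obtain the predictions $\{\theta^{(t)}_s\}_{s\ge t}$ and uncertainties $\{\epsilon^{(t)}_s\}_{s\ge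 t}$; find the largest $S$ such that $2L\sum_{s=t}^{t+S-1}\epsilon^{(t)}_s\le B$; let $(x_s)_{s=t}^{t+S-1}$ be a minimizer, over decisions in $\mathcal{X}$, of $\sum_{s=t}^{t+S-1} \big(f(x_s,\theta^{(t)}_s)+d(x_s,x_{s-1})\big)$, where $x_{t-1}$ is the decision already taken at time $t-1$; execute $x_s$, receive $\theta_s$ and pay $f(x_s,\theta_s)+d(x_s,x_{s-1})$ at times $s=t,\dots,t+S-1$; then replace $t$ by $t+S$. *)

theory Defs
  imports "HOL-Analysis.Analysis" "HOL-Library.Landau_Symbols"
begin

definition path_cost ::
  "('x \<Rightarrow> 'p \<Rightarrow> real) \<Rightarrow> ('x \<Rightarrow> 'x \<Rightarrow> real) \<Rightarrow> (nat \<Rightarrow> 'p) \<Rightarrow> nat set \<Rightarrow> (nat \<Rightarrow> 'x) \<Rightarrow> real" where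
  "path_cost f d \<theta> I y = (\<Sum>s\<in>I. f (y s) (\<theta> s) + d (y s) (y (s - 1)))"

definition feasible_path :: "'x set \<Rightarrow> 'x \<Rightarrow> nat \<Rightarrow> nat \<Rightarrow> (nat \<Rightarrow> 'x) \<Rightarrow> bool" where
  "feasible_path X z t S y \<longleftrightarrow> y (t - 1) = z \<and> (\<forall>s\<in>{t..<t + S}. y s \<in> X)"

definition cost ::
  "('x \<Rightarrow> 'p \<Rightarrow> real) \<Rightarrow> ('x \<Rightarrow> 'x \<Rightarrow> real) \<Rightarrow> (nat \<Rightarrow> 'p) \<Rightarrow> nat \<Rightarrow> (nat \<Rightarrow> 'x) \<Rightarrow> real" where
  "cost f d \<theta> T y = path_cost f d \<theta> {1..T} y"

text \<open>The offline optimum is an infimum, so that it also makes sense when no minimizing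
  path exists; for nonnegative costs it is the minimum whenever that is attained, in
  particular for finite \<open>X\<close>.\<close>

definition opt_cost ::
  "'x set \<Rightarrow> ('x \<Rightarrow> 'p \<Rightarrow> real) \<Rightarrow> ('x \<Rightarrow> 'x \<Rightarrow> real) \<Rightarrow> 'x \<Rightarrow> (nat \<Rightarrow> 'p) \<Rightarrow> nat \<Rightarrow> real" where
  "opt_cost X f d x0 \<theta> T = (INF y\<in>{y. feasible_path X x0 1 T y}. cost f d \<theta> T y)"

definition dynamic_regret ::
  "'x set \<Rightarrow> ('x \<Rightarrow> 'p \<Rightarrow> real) \<Rightarrow> ('x \<Rightarrow> 'x \<Rightarrow> real) \<Rightarrow> 'x \<Rightarrow> (nat \<Rightarrow> 'p) \<Rightarrow> nat \<Rightarrow> (nat \<Rightarrow> 'x) \<Rightarrow> real" where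
  "dynamic_regret X f d x0 \<theta> T x = cost f d \<theta> T x - opt_cost X f d x0 \<theta> T"

text \<open>\<open>pred t s\<close> and \<open>\<epsilon> t s\<close> are the prediction of \<open>\<theta> s\<close> made at time \<open>t\<close> and its
  uncertainty; only \<open>1 \<le> t \<le> s\<close> is meaningful. The features and the training enter only
  through these outputs, which are arbitrary otherwise.\<close>

definition predictive_model ::
  "'p::real_normed_vector set \<Rightarrow> (nat \<Rightarrow> 'p) \<Rightarrow> (nat \<Rightarrow> nat \<Rightarrow> 'p) \<Rightarrow> (nat \<Rightarrow> nat \<Rightarrow> real) \<Rightarrow> bool" where
  "predictive_model \<Theta> \<theta> pred \<epsilon> \<longleftrightarrow>
     (\<forall>t s. 1 \<le> t \<and> t \<le> s \<longrightarrow> pred t s \<in> \<Theta> \<and> norm (\<theta> s - pred t s) \<le> \<epsilon> t s) \<and>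
     (\<forall>t s s'. 1 \<le> t \<and> t \<le> s \<and> s \<le> s' \<longrightarrow> \<epsilon> t s \<le> \<epsilon> t s') \<and>
     (\<forall>t t' s. 1 \<le> t \<and> t \<le> t' \<and> t' \<le> s \<longrightarrow> \<epsilon> t' s \<le> \<epsilon> t s)"

definition admissible_lengths :: "real \<Rightarrow> real \<Rightarrow> (nat \<Rightarrow> nat \<Rightarrow> real) \<Rightarrow> nat \<Rightarrow> nat set" where
  "admissible_lengths L B \<epsilon> t = {S. 2 * L * (\<Sum>s=t..<t + S. \<epsilon> t s) \<le> B}"

text \<open>The largest admissible length, which may carry the plan past the horizon \<open>T\<close>.
  Two degenerate cases need a convention. If only \<open>0\<close> is admissible, the algorithm would
  not advance, so it plans a single step; if every length is admissible, there is no largest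
  one and it plans up to the horizon.\<close>

definition plan_length :: "real \<Rightarrow> real \<Rightarrow> (nat \<Rightarrow> nat \<Rightarrow> real) \<Rightarrow> nat \<Rightarrow> nat \<Rightarrow> nat" where
  "plan_length L B \<epsilon> T t =
     (if finite (admissible_lengths L B \<epsilon> t) then max 1 (Max (admissible_lengths L B \<epsilon> t))
      else T + 1 - t)"

text \<open>The values taken by the variable \<open>t\<close> of the algorithm, including the final one,
  which exceeds \<open>T\<close>.\<close>

inductive plan_time :: "real \<Rightarrow> real \<Rightarrow> (nat \<Rightarrow> nat \<Rightarrow> real) \<Rightarrow> nat \<Rightarrow> nat \<Rightarrow> bool"
  for L B \<epsilon> T where
  start: "plan_time L B \<epsilon> T 1"
| step: "plan_time L B \<epsilon> T t \<Longrightarrow> t \<le> T \<Longrightarrow> plan_time L B \<epsilon> T (t + plan_length L B \<epsilon> T t)"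

text \<open>\<open>x\<close> is a possible sequence of decisions of Dynamic Future Planning with horizon \<open>T\<close>.
  This is a relation because minimizers need not be unique.\<close>

definition dynamic_future_planning ::
  "'x set \<Rightarrow> ('x \<Rightarrow> 'p \<Rightarrow> real) \<Rightarrow> ('x \<Rightarrow> 'x \<Rightarrow> real) \<Rightarrow> 'x \<Rightarrow> real \<Rightarrow> real \<Rightarrow>
    (nat \<Rightarrow> nat \<Rightarrow> 'p) \<Rightarrow> (nat \<Rightarrow> nat \<Rightarrow> real) \<Rightarrow> nat \<Rightarrow> (nat \<Rightarrow> 'x) \<Rightarrow> bool" where
  "dynamic_future_planning X f d x0 L B pred \<epsilon> T x \<longleftrightarrow>
     x 0 = x0 \<and>
     (\<forall>t. plan_time L B \<epsilon> T t \<and> t \<le> T \<longrightarrow>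
        (let S = plan_length L B \<epsilon> T t in
          is_arg_min (path_cost f d (pred t) {t..<t + S}) (feasible_path X (x (t - 1)) t S) x))"

end

theory Submission
  imports Defs
begin

text \<open>Against any competing path, one planning block loses at most twice the accumulated
  prediction error, which is at most about \<open>B\<close>, plus one switch of cost at most \<open>B\<close> onto the
  competitor (and one more back to the plan if the block overshoots the horizon). Hence every
  block has bounded regret. Since the uncertainties at any fixed lookahead vanish, the block
  lengths tend to infinity when \<open>B > 0\<close>, so the number of blocks up to \<open>T\<close> is \<open>o(T)\<close>. If
  \<open>B = 0\<close>, there is only one decision and the regret vanishes.\<close>

section \<open>Plan lengths and planning times\<close>

lemma plan_length_ge_1: "t \<le> T \<Longrightarrow> 1 \<le> plan_length L B \<epsilon> T t"
  by (auto simp: plan_length_def)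

lemma admissible_lengths_mono:
  assumes "S \<in> admissible_lengths L B \<epsilon> t" "S' \<le> S" "0 \<le> L" "\<And>s. t \<le> s \<Longrightarrow> 0 \<le> \<epsilon> t s"
  shows "S' \<in> admissible_lengths L B \<epsilon> t"
proof -
  have "(\<Sum>s=t..<t + S'. \<epsilon> t s) \<le> (\<Sum>s=t..<t + S. \<epsilon> t s)"
    using assms by (intro sum_mono2) auto
  then have "2 * L * (\<Sum>s=t..<t + S'. \<epsilon> t s) \<le> 2 * L * (\<Sum>s=t..<t + S. \<epsilon> t s)"
    using \<open>0 \<le> L\<close> by (intro mult_left_mono) auto
  then show ?thesis
    using assms(1) by (auto simp: admissible_lengths_def)
qed

text \<open>The slack \<open>2 * L * \<epsilon> t t\<close> covers the convention that one step is
  planned when only length 0 is admissible; otherwise the plan length is itself admissible.\<close>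

lemma plan_length_error:
  assumes "0 \<le> L" "0 \<le> B" "\<And>s. t \<le> s \<Longrightarrow> 0 \<le> \<epsilon> t s"
  shows "2 * L * (\<Sum>s=t..<t + plan_length L B \<epsilon> T t. \<epsilon> t s) \<le> B + 2 * L * \<epsilon> t t"
proof -
  let ?A = "admissible_lengths L B \<epsilon> t"
  have nonneg: "0 \<le> 2 * L * \<epsilon> t t" using assms by simp
  have admissible: "2 * L * (\<Sum>s=t..<t + S. \<epsilon> t s) \<le> B + 2 * L * \<epsilon> t t" if "S \<in> ?A" for S
    using that nonneg by (simp add: admissible_lengths_def)
  show ?thesis
  proof (cases "finite ?A")
    case True
    have "0 \<in> ?A" using \<open>0 \<le> B\<close> by (simp add: admissible_lengths_def)
    with True have "Max ?A \<in> ?A" by (auto intro: Max_in)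
    show ?thesis
    proof (cases "1 \<le> Max ?A")
      case True
      then show ?thesis
        using \<open>finite ?A\<close> admissible[OF \<open>Max ?A \<in> ?A\<close>] by (simp add: plan_length_def max_absorb2)
    next
      case False
      then have "plan_length L B \<epsilon> T t = 1"
        using \<open>finite ?A\<close> by (simp add: plan_length_def)
      then show ?thesis using \<open>0 \<le> B\<close> by simp
    qed
  next
    case False
    \<comment> \<open>The uncertainties are nonnegative, so every length below an admissible one is
      admissible. An unbounded set of lengths therefore contains the one that reaches the
      horizon.\<close>
    then obtain S where "S \<in> ?A" "T + 1 - t \<le> S"
      using infinite_nat_iff_unbounded_le by blast
    then have "T + 1 - t \<in> ?A"
      using admissible_lengths_mono[OF _ _ assms(1)] assms(3) by blast
    then show ?thesis using False admissible by (simp add: plan_length_def)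
  qed
qed

text \<open>The second alternative is for the case where all lengths are admissible: the plan then
  ends at the horizon and may be shorter than \<open>K\<close>.\<close>

lemma admissible_le_plan_length:
  assumes "K \<in> admissible_lengths L B \<epsilon> t"
  shows "K \<le> plan_length L B \<epsilon> T t \<or> T < t + plan_length L B \<epsilon> T t"
  using assms by (auto simp: plan_length_def intro: max.coboundedI2 Max_ge)

lemma plan_time_ge_1: "plan_time L B \<epsilon> T t \<Longrightarrow> 1 \<le> t"
  by (induction rule: plan_time.induct) auto

text \<open>If no planning time exceeded \<open>T\<close>, there would be a latest one, and a plan
  of length at least 1 leads beyond it.\<close>

lemma plan_time_final: "\<exists>t. plan_time L B \<epsilon> T t \<and> T < t"
proof (rule ccontr)
  let ?P = "{t. plan_time L B \<epsilon> T t}"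
  assume "\<not> ?thesis"
  then have bounded: "?P \<subseteq> {..T}" by force
  then have "finite ?P" using finite_subset by blast
  have "Max ?P \<in> ?P"
    using plan_time.start by (intro Max_in \<open>finite ?P\<close>) blast
  then have "Max ?P + plan_length L B \<epsilon> T (Max ?P) \<in> ?P"
    using bounded plan_time.step by blast
  then have "Max ?P + plan_length L B \<epsilon> T (Max ?P) \<le> Max ?P"
    using \<open>finite ?P\<close> by (rule Max_ge[rotated])
  moreover have "1 \<le> plan_length L B \<epsilon> T (Max ?P)"
    using \<open>Max ?P \<in> ?P\<close> bounded by (intro plan_length_ge_1) blast
  ultimately show False by linarith
qed

text \<open>For fixed \<open>K\<close> the error sum has \<open>K\<close> terms, each at a fixed
  lookahead and so vanishing as \<open>t\<close> grows. It finally drops below the positive budget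
  \<open>B\<close>.\<close>

lemma eventually_admissible:
  assumes "0 < B" "\<And>s. 1 \<le> s \<Longrightarrow> (\<lambda>t. \<epsilon> t (t + s - 1)) \<longlonglongrightarrow> 0"
  shows "eventually (\<lambda>t. K \<in> admissible_lengths L B \<epsilon> t) sequentially"
proof -
  have "(\<lambda>t. \<epsilon> t (t + s)) \<longlonglongrightarrow> 0" for s
    using assms(2)[of "Suc s"] by simp
  then have "(\<lambda>t. 2 * L * (\<Sum>s<K. \<epsilon> t (t + s))) \<longlonglongrightarrow> 2 * L * (\<Sum>s<K. 0)"
    by (intro tendsto_intros)
  then have "eventually (\<lambda>t. 2 * L * (\<Sum>s<K. \<epsilon> t (t + s)) < B) sequentially"
    using \<open>0 < B\<close> by (auto dest: order_tendstoD(2))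
  moreover have "(\<Sum>s=t..<t + K. \<epsilon> t s) = (\<Sum>s<K. \<epsilon> t (t + s))" for t
    using sum.shift_bounds_nat_ivl[of "\<epsilon> t" 0 t K]
    by (simp add: atLeast0LessThan add.commute)
  ultimately show ?thesis
    by (auto simp: admissible_lengths_def elim: eventually_mono)
qed

section \<open>Regret of a single block\<close>

text \<open>The competitor \<open>z\<close> to the plan follows \<open>y\<close> until the horizon and the plan itself
  afterwards; it pays one switch at \<open>t\<close> and possibly one at \<open>e\<close>.\<close>

lemma block_regret:
  assumes d: "\<And>u v. u \<in> X \<Longrightarrow> v \<in> X \<Longrightarrow> 0 \<le> d u v \<and> d u v \<le> B"
    and lip: "\<And>u. u \<in> X \<Longrightarrow> L-lipschitz_on \<Theta> (f u)"
    and "0 \<le> L" "0 \<le> B"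
    and pred: "\<And>s. t \<le> s \<Longrightarrow> \<theta> s \<in> \<Theta> \<and> q s \<in> \<Theta> \<and> norm (\<theta> s - q s) \<le> \<delta> s"
    and min: "is_arg_min (path_cost f d q {t..<t + S}) (feasible_path X (x (t - 1)) t S) x"
    and "1 \<le> t" "t < e" "e \<le> t + S"
    and x: "x (t - 1) \<in> X" and y: "\<And>s. t - 1 \<le> s \<Longrightarrow> s < e \<Longrightarrow> y s \<in> X"
  shows "path_cost f d \<theta> {t..<e} x \<le> path_cost f d \<theta> {t..<e} y
    + 2 * L * (\<Sum>s=t..<t + S. \<delta> s) + 2 * B"
proof -
  define h where "h u s = f (u s) (q s) + d (u s) (u (s - 1))" for u s
  define z where "z s = (if t \<le> s \<and> s < e then y s else x s)" for s
  have xX: "x s \<in> X" if "t - 1 \<le> s" "s < t + S" for s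
  proof (cases "s = t - 1")
    case False
    with that have "t \<le> s" by simp
    with that min show ?thesis by (auto simp: is_arg_min_def feasible_path_def)
  qed (use x in simp)
  have "feasible_path X (x (t - 1)) t S z"
    using \<open>1 \<le> t\<close> xX y by (auto simp: feasible_path_def z_def)
  then have "(\<Sum>s=t..<t + S. h x s) \<le> (\<Sum>s=t..<t + S. h z s)"
    using min by (auto simp: is_arg_min_def path_cost_def h_def not_less)
  \<comment> \<open>Except at \<open>t\<close> and \<open>e\<close>, both \<open>z s\<close> and
    \<open>z (s - 1)\<close> come from the same path, so the stage costs agree. At these two times
    the switch of \<open>z\<close> costs at most \<open>B\<close>, and the switching cost on the
    right is nonnegative.\<close>
  also have "\<dots> \<le> (\<Sum>s=t..<t + S. (if s < e then h y s else h x s)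
      + ((if s = t then B else 0) + (if s = e then B else 0)))"
  proof (rule sum_mono)
    fix s assume s: "s \<in> {t..<t + S}"
    then have "z s \<in> X" "z (s - 1) \<in> X"
      using xX y \<open>1 \<le> t\<close> by (auto simp: z_def)
    then have dz: "0 \<le> d (z s) (z (s - 1))" "d (z s) (z (s - 1)) \<le> B"
      using d by auto
    consider "s = t" | "t < s" "s < e" | "s = e" | "e < s"
      using s by fastforce
    then show "h z s \<le> (if s < e then h y s else h x s)
      + ((if s = t then B else 0) + (if s = e then B else 0))"
    proof cases
      case 1
      then have "0 \<le> d (y s) (y (s - 1))"
        using d y \<open>t < e\<close> by simp
      with 1 dz show ?thesis using \<open>t < e\<close> \<open>0 \<le> B\<close> by (simp add: h_def z_def)
    next
      case 2
      then show ?thesis using \<open>0 \<le> B\<close> by (auto simp: h_def z_def)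
    next
      case 3
      then have "0 \<le> d (x s) (x (s - 1))"
        using d xX s \<open>t < e\<close> by simp
      with 3 dz show ?thesis using \<open>t < e\<close> \<open>0 \<le> B\<close> by (simp add: h_def z_def)
    next
      case 4
      then show ?thesis using \<open>0 \<le> B\<close> \<open>t < e\<close> by (auto simp: h_def z_def)
    qed
  qed
  also have "\<dots> \<le> (\<Sum>s=t..<t + S. if s < e then h y s else h x s) + 2 * B"
    using \<open>0 \<le> B\<close> by (auto simp: sum.distrib)
  also have "(\<Sum>s=t..<t + S. if s < e then h y s else h x s)
      = (\<Sum>s=t..<e. h y s) + (\<Sum>s=e..<t + S. h x s)"
    using \<open>t < e\<close> \<open>e \<le> t + S\<close> by (simp add: sum.atLeastLessThan_concat[of t e "t + S", symmetric])
  \<comment> \<open>The part of \<open>x\<close> from \<open>e\<close> on occurs on both sides and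
    cancels.\<close>
  finally have plan: "(\<Sum>s=t..<e. h x s) \<le> (\<Sum>s=t..<e. h y s) + 2 * B"
    using \<open>t < e\<close> \<open>e \<le> t + S\<close> by (simp add: sum.atLeastLessThan_concat[of t e "t + S", symmetric])

  have err: "\<bar>f u (\<theta> s) - f u (q s)\<bar> \<le> L * \<delta> s" if "u \<in> X" "t \<le> s" for u s
  proof -
    have "\<bar>f u (\<theta> s) - f u (q s)\<bar> \<le> L * norm (\<theta> s - q s)"
      using lipschitz_onD[OF lip[OF that(1)], of "\<theta> s" "q s"] pred[OF that(2)]
      by (simp add: dist_norm)
    also have "\<dots> \<le> L * \<delta> s"
      using pred[OF that(2)] \<open>0 \<le> L\<close> by (intro mult_left_mono) auto
    finally show ?thesis .
  qed
  have shift: "(\<Sum>s=t..<e. g s + L * \<delta> s) = (\<Sum>s=t..<e. g s) + L * (\<Sum>s=t..<e. \<delta> s)" for g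
    by (simp add: sum.distrib sum_distrib_left)
  have "path_cost f d \<theta> {t..<e} x \<le> (\<Sum>s=t..<e. h x s + L * \<delta> s)"
    unfolding path_cost_def
  proof (rule sum_mono)
    fix s assume "s \<in> {t..<e}"
    then show "f (x s) (\<theta> s) + d (x s) (x (s - 1)) \<le> h x s + L * \<delta> s"
      using err[of "x s" s] xX[of s] \<open>e \<le> t + S\<close> by (simp add: h_def)
  qed
  moreover have "(\<Sum>s=t..<e. h y s) \<le> (\<Sum>s=t..<e. f (y s) (\<theta> s) + d (y s) (y (s - 1)) + L * \<delta> s)"
  proof (rule sum_mono)
    fix s assume "s \<in> {t..<e}"
    then show "h y s \<le> f (y s) (\<theta> s) + d (y s) (y (s - 1)) + L * \<delta> s"
      using err[of "y s" s] y[of s] by (simp add: h_def)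
  qed
  \<comment> \<open>The prediction error is charged twice: for \<open>x\<close> in passing from true
    to predicted costs, and for \<open>y\<close> in passing back.\<close>
  ultimately have "path_cost f d \<theta> {t..<e} x
      \<le> path_cost f d \<theta> {t..<e} y + 2 * (L * (\<Sum>s=t..<e. \<delta> s)) + 2 * B"
    using plan unfolding shift path_cost_def by linarith
  \<comment> \<open>The planning rule controls the error of the whole block, so the sum is extended
    past a possible cut at \<open>e\<close>.\<close>
  moreover have "2 * L * (\<Sum>s=t..<e. \<delta> s) \<le> 2 * L * (\<Sum>s=t..<t + S. \<delta> s)"
  proof (intro mult_left_mono sum_mono2)
    show "0 \<le> \<delta> s" if "s \<in> {t..<t + S} - {t..<e}" for s
      using pred[of s] that \<open>t < e\<close> by (auto intro: order_trans[OF norm_ge_zero])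
  qed (use \<open>0 \<le> L\<close> \<open>e \<le> t + S\<close> in auto)
  ultimately show ?thesis by linarith
qed

text \<open>Each block keeps its own decisions in \<open>X\<close>. Applied to a planning time
  beyond \<open>T\<close>, this covers all decisions up to the horizon.\<close>

lemma plan_time_feasible:
  assumes "plan_time L B \<epsilon> T t" "dynamic_future_planning X f d x0 L B pred \<epsilon> T x" "x0 \<in> X"
    "s < t"
  shows "x s \<in> X"
  using assms(1,4)
proof (induction arbitrary: s rule: plan_time.induct)
  case start
  then show ?case using assms(2,3) by (simp add: dynamic_future_planning_def)
next
  case (step t)
  then show ?case
    using assms(2) by (cases "s < t")
      (auto simp: dynamic_future_planning_def Let_def is_arg_min_def feasible_path_def)
qed

section \<open>Counting the blocks\<close>

text \<open>Blocks of bounded regret \<open>C\<close> are counted: at most \<open>N\<close> of them start before \<open>N\<close>, the later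
  ones have length at least \<open>K\<close>, and the last one may be cut off by the horizon.\<close>

lemma regret_block_count:
  assumes block: "\<And>t e. plan_time L B \<epsilon> T t \<Longrightarrow> t < e \<Longrightarrow> e \<le> T + 1
      \<Longrightarrow> e \<le> t + plan_length L B \<epsilon> T t
      \<Longrightarrow> path_cost f d \<theta> {t..<e} x \<le> path_cost f d \<theta> {t..<e} y + C"
    and "0 \<le> C" "1 \<le> K"
    and long: "\<And>t. N \<le> t \<Longrightarrow> t \<le> T
      \<Longrightarrow> K \<le> plan_length L B \<epsilon> T t \<or> T < t + plan_length L B \<epsilon> T t"
  shows "cost f d \<theta> T x \<le> cost f d \<theta> T y + C * (real N + real T / real K + 1)"
proof -
  define D where "D e = path_cost f d \<theta> {1..<e} x - path_cost f d \<theta> {1..<e} y" for e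
  have D_step: "D e \<le> D t + C"
    if "plan_time L B \<epsilon> T t" "t < e" "e \<le> T + 1" "e \<le> t + plan_length L B \<epsilon> T t" for t e
  proof -
    have "path_cost f d \<theta> {1..<e} u = path_cost f d \<theta> {1..<t} u + path_cost f d \<theta> {t..<e} u" for u
      unfolding path_cost_def using plan_time_ge_1[OF that(1)] \<open>t < e\<close>
      by (simp add: sum.atLeastLessThan_concat)
    from this[of x] this[of y] show ?thesis using block[OF that] unfolding D_def by linarith
  qed
  \<comment> \<open>The factor after \<open>C\<close> bounds the number of blocks completed before
    \<open>t\<close>: \<open>min (t - 1) N\<close> for those starting before \<open>N\<close>, and
    \<open>(t - 1) / K\<close> for the later, long ones. Once \<open>t\<close> exceeds
    \<open>T\<close>, the regret is read off at \<open>T + 1\<close>, without the overshoot.\<close>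
  have "if t \<le> T then D t \<le> C * (real (min (t - 1) N) + real (t - 1) / real K)
      else D (T + 1) \<le> C * (real N + real T / real K + 1)"
    if "plan_time L B \<epsilon> T t" for t
    using that
  proof (induction rule: plan_time.induct)
    case start
    then show ?case using \<open>0 \<le> C\<close> by (auto simp: D_def path_cost_def)
  next
    case (step t)
    let ?S = "plan_length L B \<epsilon> T t"
    have "1 \<le> t" using step plan_time_ge_1 by blast
    have "1 \<le> ?S" using step plan_length_ge_1 by blast
    have IH: "D t \<le> C * (real (min (t - 1) N) + real (t - 1) / real K)"
      using step by simp
    show ?case
    proof (cases "t + ?S \<le> T")
      case True
      \<comment> \<open>One more block raises the bound by at least 1: through the first term if
        \<open>t < N\<close>, through the second otherwise.\<close>
      have "real (min (t - 1) N) + real (t - 1) / real K + 1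
          \<le> real (min (t + ?S - 1) N) + real (t + ?S - 1) / real K"
      proof (cases "t < N")
        case True
        then have "real (min (t - 1) N) + 1 \<le> real (min (t + ?S - 1) N)"
          using \<open>1 \<le> t\<close> \<open>1 \<le> ?S\<close> by linarith
        moreover have "real (t - 1) / real K \<le> real (t + ?S - 1) / real K"
          by (intro divide_right_mono) auto
        ultimately show ?thesis by linarith
      next
        case False
        then have "K \<le> ?S" using long[of t] step \<open>t + ?S \<le> T\<close> by simp
        then have "real (t - 1) + real K \<le> real (t + ?S - 1)"
          using \<open>1 \<le> t\<close> by linarith
        then have *: "(real (t - 1) + real K) / real K \<le> real (t + ?S - 1) / real K"
          by (intro divide_right_mono) auto
        have "real K / real K = 1" using \<open>1 \<le> K\<close> by simp
        with * have "real (t - 1) / real K + 1 \<le> real (t + ?S - 1) / real K"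
          unfolding add_divide_distrib by linarith
        moreover have "real (min (t - 1) N) \<le> real (min (t + ?S - 1) N)" by simp
        ultimately show ?thesis by linarith
      qed
      then have "C * (real (min (t - 1) N) + real (t - 1) / real K + 1)
          \<le> C * (real (min (t + ?S - 1) N) + real (t + ?S - 1) / real K)"
        using \<open>0 \<le> C\<close> by (rule mult_left_mono)
      then show ?thesis
        using True IH D_step[of t "t + ?S"] step \<open>1 \<le> ?S\<close>
        by (simp add: distrib_left)
    next
      case False
      \<comment> \<open>The block that crosses the horizon may be short before the cut; the final
        \<open>+ 1\<close> pays for it.\<close>
      have "real (t - 1) / real K \<le> real T / real K"
        using \<open>t \<le> T\<close> by (intro divide_right_mono) auto
      then have "C * (real (min (t - 1) N) + real (t - 1) / real K + 1)
          \<le> C * (real N + real T / real K + 1)"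
        using \<open>0 \<le> C\<close> by (intro mult_left_mono add_mono) auto
      then show ?thesis
        using False IH D_step[of t "T + 1"] step by (simp add: distrib_left)
    qed
  qed
  then have "D (T + 1) \<le> C * (real N + real T / real K + 1)"
    using plan_time_final[of L B \<epsilon> T] by (metis not_le)
  moreover have "D (T + 1) = cost f d \<theta> T x - cost f d \<theta> T y"
    by (simp add: D_def cost_def atLeastLessThanSuc_atLeastAtMost)
  ultimately show ?thesis by simp
qed

section \<open>Sublinearity of the regret\<close>

theorem theorem3p6:
  fixes X :: "'x set" and \<Theta> :: "'p::real_normed_vector set"
    and f :: "'x \<Rightarrow> 'p \<Rightarrow> real" and d :: "'x \<Rightarrow> 'x \<Rightarrow> real"
    and L B :: real and x0 :: 'x and \<theta> :: "nat \<Rightarrow> 'p"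
    and pred :: "nat \<Rightarrow> nat \<Rightarrow> 'p" and \<epsilon> :: "nat \<Rightarrow> nat \<Rightarrow> real"
    and x :: "nat \<Rightarrow> nat \<Rightarrow> 'x"
  assumes "Metric_space X d"
    and "x0 \<in> X"
    and "\<And>t. 1 \<le> t \<Longrightarrow> \<theta> t \<in> \<Theta>"
    and "\<And>y p. y \<in> X \<Longrightarrow> p \<in> \<Theta> \<Longrightarrow> 0 \<le> f y p"
    and "\<And>y. y \<in> X \<Longrightarrow> L-lipschitz_on \<Theta> (f y)"
    and "bdd_above ((\<lambda>(y, z). d y z) ` (X \<times> X))"
    and "B = (SUP (y, z)\<in>X \<times> X. d y z)"
    and "predictive_model \<Theta> \<theta> pred \<epsilon>"
    and "\<And>s. 1 \<le> s \<Longrightarrow> (\<lambda>t. \<epsilon> t (t + s - 1)) \<longlonglongrightarrow> 0"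
    and "\<And>T. dynamic_future_planning X f d x0 L B pred \<epsilon> T (x T)"
  shows "(\<lambda>T. dynamic_regret X f d x0 \<theta> T (x T)) \<in> o(\<lambda>T. real T)"
proof -
  interpret Metric_space X d by (rule assms)
  let ?reg = "\<lambda>T. dynamic_regret X f d x0 \<theta> T (x T)"
  have d: "0 \<le> d u v \<and> d u v \<le> B" if "u \<in> X" "v \<in> X" for u v
    using that cSUP_upper[OF _ assms(6), of "(u, v)"] assms(7) by auto
  have "0 \<le> B" using d \<open>x0 \<in> X\<close> by force
  have "0 \<le> L" using assms(5) \<open>x0 \<in> X\<close> lipschitz_on_nonneg by blast
  have pred: "pred t s \<in> \<Theta> \<and> norm (\<theta> s - pred t s) \<le> \<epsilon> t s" if "1 \<le> t" "t \<le> s" for t s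
    using assms(8) that by (simp add: predictive_model_def)
  have \<epsilon>_nonneg: "0 \<le> \<epsilon> t s" if "1 \<le> t" "t \<le> s" for t s
    using pred[OF that] norm_ge_zero[of "\<theta> s - pred t s"] by linarith
  have x0: "x T 0 = x0" for T
    using assms(10)[of T] by (simp add: dynamic_future_planning_def)
  have xX: "x T s \<in> X" if "s \<le> T" for T s
    using plan_time_final[of L B \<epsilon> T] plan_time_feasible[OF _ assms(10,2)] that
    by (meson le_less_trans)
  have yX: "y s \<in> X" if "feasible_path X x0 1 T y" "s \<le> T" for y T s
    using that \<open>x0 \<in> X\<close> by (cases "s = 0") (auto simp: feasible_path_def)
  \<comment> \<open>A bound against every competitor passes to the infimum; the constant path shows
    that competitors exist.\<close>
  have reg_le: "?reg T \<le> c"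
    if "\<And>y. feasible_path X x0 1 T y \<Longrightarrow> cost f d \<theta> T (x T) \<le> cost f d \<theta> T y + c" for T c
  proof -
    have "feasible_path X x0 1 T (\<lambda>_. x0)"
      using \<open>x0 \<in> X\<close> by (simp add: feasible_path_def)
    then have "cost f d \<theta> T (x T) - c \<le> opt_cost X f d x0 \<theta> T"
      unfolding opt_cost_def using that by (intro cINF_greatest) (auto simp: algebra_simps)
    then show ?thesis by (simp add: dynamic_regret_def)
  qed
  \<comment> \<open>Little-o concerns absolute values, so a lower bound is needed too. Nonnegative
    costs bound the infimum from below, and the executed path is itself a competitor.\<close>
  have reg_nonneg: "0 \<le> ?reg T" for T
  proof -
    have "0 \<le> cost f d \<theta> T y" if "feasible_path X x0 1 T y" for y
      unfolding cost_def path_cost_def using that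
      by (intro sum_nonneg add_nonneg_nonneg nonneg assms(4) assms(3)) (auto intro: yX)
    then have "bdd_below (cost f d \<theta> T ` {y. feasible_path X x0 1 T y})"
      by (intro bdd_belowI[of _ 0]) auto
    moreover have "feasible_path X x0 1 T (x T)"
      using x0 xX by (simp add: feasible_path_def)
    ultimately show ?thesis
      by (simp add: dynamic_regret_def opt_cost_def cINF_lower)
  qed

  show ?thesis
  \<comment> \<open>With a zero error budget the plans need not become long, so this case cannot go
    through \<open>eventually_admissible\<close>.\<close>
  proof (cases "B = 0")
    case True
    have single: "u = v" if "u \<in> X" "v \<in> X" for u v
    proof -
      have "d u v = 0" using d[OF that] True by (intro antisym) auto
      then show ?thesis using zero[OF that] by simp
    qed
    have "?reg T \<le> 0" for T
    proof (rule reg_le)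
      fix y assume y: "feasible_path X x0 1 T y"
      have "x T s = y s" if "s \<le> T" for s
        using single xX yX[OF y] that by blast
      then have "cost f d \<theta> T (x T) = cost f d \<theta> T y"
        unfolding cost_def path_cost_def by (intro sum.cong) auto
      then show "cost f d \<theta> T (x T) \<le> cost f d \<theta> T y + 0" by simp
    qed
    then have "?reg T = 0" for T using reg_nonneg[of T] by (simp add: antisym)
    then show ?thesis by simp
  next
    case False
    with \<open>0 \<le> B\<close> have "0 < B" by simp
    have "(\<lambda>t. \<epsilon> t t) \<longlonglongrightarrow> 0" using assms(9)[of 1] by simp
    then have "Bseq (\<lambda>t. \<epsilon> t t)" by (intro convergent_imp_Bseq convergentI)
    then obtain M where "\<forall>t. norm (\<epsilon> t t) \<le> M" unfolding Bseq_def by blast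
    then have M: "\<epsilon> t t \<le> M" for t by (simp add: abs_le_iff)
    have "0 \<le> M" using M[of 1] \<epsilon>_nonneg[of 1 1] by linarith
    \<comment> \<open>Two switches cost \<open>2 * B\<close>; the prediction error of a block adds
      at most \<open>B + 2 * L * M\<close>.\<close>
    define C where "C = 3 * B + 2 * L * M"
    have "0 \<le> C" using \<open>0 \<le> B\<close> \<open>0 \<le> L\<close> \<open>0 \<le> M\<close> by (simp add: C_def)
    have block: "path_cost f d \<theta> {t..<e} (x T) \<le> path_cost f d \<theta> {t..<e} y + C"
      if y: "feasible_path X x0 1 T y" and t: "plan_time L B \<epsilon> T t"
        and e: "t < e" "e \<le> T + 1" "e \<le> t + plan_length L B \<epsilon> T t" for T y t e
    proof -
      have "1 \<le> t" using t by (rule plan_time_ge_1)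
      have "path_cost f d \<theta> {t..<e} (x T) \<le> path_cost f d \<theta> {t..<e} y
          + 2 * L * (\<Sum>s=t..<t + plan_length L B \<epsilon> T t. \<epsilon> t s) + 2 * B"
      proof (rule block_regret[where X = X and \<Theta> = \<Theta> and q = "pred t"])
        show "is_arg_min (path_cost f d (pred t) {t..<t + plan_length L B \<epsilon> T t})
            (feasible_path X (x T (t - 1)) t (plan_length L B \<epsilon> T t)) (x T)"
          using assms(10)[of T] t e by (simp add: dynamic_future_planning_def Let_def)
      qed (use d assms(3,5) \<open>0 \<le> L\<close> \<open>0 \<le> B\<close> pred \<open>1 \<le> t\<close> e xX yX[OF y] in auto)
      also have "2 * L * (\<Sum>s=t..<t + plan_length L B \<epsilon> T t. \<epsilon> t s) \<le> B + 2 * L * \<epsilon> t t"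
        using \<open>0 \<le> L\<close> \<open>0 \<le> B\<close> \<epsilon>_nonneg \<open>1 \<le> t\<close> by (intro plan_length_error) auto
      also have "2 * L * \<epsilon> t t \<le> 2 * L * M"
        using \<open>0 \<le> L\<close> M by (intro mult_left_mono) auto
      finally show ?thesis by (simp add: C_def)
    qed
    show ?thesis
    proof (rule landau_o.smallI)
      fix c :: real assume "0 < c"
      \<comment> \<open>\<open>K\<close> makes the share \<open>C / K\<close> per time step at most
        \<open>c / 2\<close>. The resulting \<open>N\<close> does not depend on \<open>T\<close>, so
        the remaining constant \<open>C * (N + 1)\<close> is below \<open>c / 2 * T\<close> for
        large \<open>T\<close>.\<close>
      obtain K :: nat where K: "2 * C / c < K" using reals_Archimedean2 by blast
      moreover have "0 \<le> 2 * C / c" using \<open>0 < c\<close> \<open>0 \<le> C\<close> by simp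
      ultimately have "0 < K" by linarith
      then have CK: "C / real K \<le> c / 2"
        using K \<open>0 < c\<close> by (simp add: field_simps)
      obtain N where N: "\<And>t. N \<le> t \<Longrightarrow> K \<in> admissible_lengths L B \<epsilon> t"
        using eventually_admissible[of B \<epsilon> K L, OF \<open>0 < B\<close> assms(9)]
        unfolding eventually_sequentially by blast
      have "?reg T \<le> C * (real N + real T / real K + 1)" for T
        using block admissible_le_plan_length[OF N, of _ T] \<open>0 \<le> C\<close> \<open>0 < K\<close>
        by (intro reg_le regret_block_count[of L B \<epsilon> T]) auto
      moreover have "C * (real N + real T / real K + 1) \<le> c * real T"
        if "2 * C * (real N + 1) / c \<le> real T" for T
      proof -
        have "C * (real N + 1) \<le> c / 2 * real T"
          using that \<open>0 < c\<close> by (simp add: field_simps)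
        moreover have "C / real K * real T \<le> c / 2 * real T"
          using CK by (intro mult_right_mono) auto
        moreover have "C * (real N + real T / real K + 1) = C * (real N + 1) + C / real K * real T"
          by (simp add: algebra_simps)
        ultimately show ?thesis by linarith
      qed
      moreover have "eventually (\<lambda>T. 2 * C * (real N + 1) / c \<le> real T) sequentially"
        by (rule eventually_at_top_linorderI[of "nat \<lceil>2 * C * (real N + 1) / c\<rceil>"]) linarith
      ultimately show "eventually (\<lambda>T. norm (?reg T) \<le> c * norm (real T)) sequentially"
        using reg_nonneg by (auto elim!: eventually_mono intro: order_trans)
    qed
  qed
qed

end
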